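(* Let $n\ge 1$ and let $K_{n+1}$ be the complete graph on the $n+1$ vertices $v_1,\dots,v_n,s$ with sink $s$. For $0\le m\le n$, let $\lambda_m$ denote the number of principal avalanches of size $m$ in $K_{n+1}$. Then $$\mathscr{A}_{K_{n+1}}(x_1,\dots,x_n)=\sum_{m=0}^n \frac{\lambda_m}{\binom{n}{m}}\, e_m(x_1,\dots,x_n),$$ where $e_m(x_1,\dots,x_n)=\sum_{A\subseteq\{1,\dots,n\},\,|A|=m}\ \prod_{i\in A}x_i$ is the elementary symmetric polynomial of degree $m$.
   Context: A graph $G=(V,E,s)$ is a finite connected undirected multigraph without loops, with a distinguished vertex $s$ called the sink; $\widetilde V = V\setminus\{s\}$. $d_v$ is the degree of $v$ (counted with multiplicity, including edges to $s$) and $\mathrm{wt}(u,v)$ is the number of edges between $u$ and $v$. A sandpile is a function $c:\widetilde V\to\mathbb{Z}_{\ge 0}$. A vertex $v\in\widetilde V$ is unstable if $c(v)\ge d_v$; an unstable vertex may topple, which replaces $c$ by $c'$ with $c'(v)=c(v)-d_v$ and $c'(w)=c(w)+\mathrm{wt}(v,w)$ for $w\in\widetilde V$, $w\ne v$. A sandpile is stable if it has no unstable vertex. Any sequence of topplings of unstable vertices starting at $c$ that ends in a stable sandpile ends in the same stable sandpile $c^\circ$ (the stabilization), with the same number of topplings of each vertex; the vector of these numbers is the toppling vector of the stabilization. Put $a\oplus b=(a+b)^\circ$. A stable sandpile $c$ is recurrent if for every sandpile $a$ there is a sandpile $b$ with $a\oplus b=c$; the set of recurrent sandpiles is $\mathscr{S}(G)$.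 For $v\in\widetilde V$, $1_v$ is the sandpile with one grain at $v$ and none elsewhere. For $c$ recurrent and $v\in\widetilde V$, the principal avalanche of $c$ at $v$ is the sequence of topplings in the stabilization of $c+1_v$; its size is the total number of topplings. The number of principal avalanches of size $m$ is the number of pairs $(c,v)\in\mathscr{S}(G)\times\widetilde V$ whose principal avalanche has size $m$. For $\widetilde V=\{v_1,\dots,v_n\}$, the avalanche monomial is $\mu_G(c,v_k)=\prod_{i=1}^n x_i^{f_i}$, where $(f_1,\dots,f_n)$ is the toppling vector of the stabilization of $c+1_{v_k}$. The multivariate avalanche polynomial is $\mathscr{A}_G(x_1,\dots,x_n)=\sum_{c\in\mathscr{S}(G)}\sum_{v\in\widetilde V}\mu_G(c,v)$. *)

theory Defs
  imports Complex_Main "HOL-Library.Poly_Mapping"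
begin

section \<open>Multigraphs with a sink\<close>

text \<open>
  A loopless undirected multigraph is given by its vertices and its edge multiplicities;
  only the values \<open>wt G u v\<close> with \<open>u\<close> and \<open>v\<close> vertices are relevant.
\<close>

record 'v sink_graph =
  verts :: "'v set"
  wt :: "'v \<Rightarrow> 'v \<Rightarrow> nat"
  sink :: 'v

definition wf_sink_graph :: "'v sink_graph \<Rightarrow> bool" where
  "wf_sink_graph G \<longleftrightarrow>
     finite (verts G) \<and> sink G \<in> verts G \<and>
     (\<forall>u\<in>verts G. \<forall>v\<in>verts G. wt G u v = wt G v u) \<and>
     (\<forall>v\<in>verts G. wt G v v = 0) \<and>
     (\<forall>u\<in>verts G. \<forall>v\<in>verts G.
        (\<lambda>x y. x \<in> verts G \<and> y \<in> verts G \<and> wt G x y > 0)\<^sup>*\<^sup>* u v)"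

definition nonsink :: "'v sink_graph \<Rightarrow> 'v set" where
  "nonsink G = verts G - {sink G}"

definition deg :: "'v sink_graph \<Rightarrow> 'v \<Rightarrow> nat" where
  "deg G v = (\<Sum>u\<in>verts G. wt G v u)"

section \<open>Sandpiles, toppling and stabilization\<close>

text \<open>
  Functions on the non-sink vertices are represented by functions on the whole vertex type that
  vanish elsewhere, so that each sandpile has exactly one representative.
\<close>

definition sandpiles :: "'v sink_graph \<Rightarrow> ('v \<Rightarrow> nat) set" where
  "sandpiles G = {c. \<forall>v. v \<notin> nonsink G \<longrightarrow> c v = 0}"

definition unstable :: "'v sink_graph \<Rightarrow> ('v \<Rightarrow> nat) \<Rightarrow> 'v \<Rightarrow> bool" where
  "unstable G c v \<longleftrightarrow> v \<in> nonsink G \<and> c v \<ge> deg G v"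

definition stable :: "'v sink_graph \<Rightarrow> ('v \<Rightarrow> nat) \<Rightarrow> bool" where
  "stable G c \<longleftrightarrow> (\<forall>v. \<not> unstable G c v)"

text \<open>The subtraction below is only used at unstable \<open>v\<close>, where it does not truncate.\<close>

definition topple :: "'v sink_graph \<Rightarrow> 'v \<Rightarrow> ('v \<Rightarrow> nat) \<Rightarrow> 'v \<Rightarrow> nat" where
  "topple G v c =
     (\<lambda>w. if w = v then c w - deg G w
          else if w \<in> nonsink G then c w + wt G v w
          else c w)"

inductive topplings :: "'v sink_graph \<Rightarrow> ('v \<Rightarrow> nat) \<Rightarrow> 'v list \<Rightarrow> ('v \<Rightarrow> nat) \<Rightarrow> bool"
  for G :: "'v sink_graph" where
  Nil: "topplings G c [] c"
| Cons: "unstable G c v \<Longrightarrow> topplings G (topple G v c) vs c' \<Longrightarrow> topplings G c (v # vs) c'"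

text \<open>
  For well-formed graphs the following two descriptions denote, because toppling terminates and
  neither the final sandpile nor the number of topplings of each vertex depends on the order
  of topplings.
\<close>

definition stabilization :: "'v sink_graph \<Rightarrow> ('v \<Rightarrow> nat) \<Rightarrow> 'v \<Rightarrow> nat" where
  "stabilization G c = (THE c'. stable G c' \<and> (\<exists>vs. topplings G c vs c'))"

definition toppling_vector :: "'v sink_graph \<Rightarrow> ('v \<Rightarrow> nat) \<Rightarrow> 'v \<Rightarrow> nat" where
  "toppling_vector G c =
     (THE f. \<exists>vs c'. topplings G c vs c' \<and> stable G c' \<and> f = count_list vs)"

definition stable_add :: "'v sink_graph \<Rightarrow> ('v \<Rightarrow> nat) \<Rightarrow> ('v \<Rightarrow> nat) \<Rightarrow> 'v \<Rightarrow> nat" where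
  "stable_add G a b = stabilization G (\<lambda>v. a v + b v)"

definition recurrents :: "'v sink_graph \<Rightarrow> ('v \<Rightarrow> nat) set" where
  "recurrents G =
     {c \<in> sandpiles G. stable G c \<and>
        (\<forall>a\<in>sandpiles G. \<exists>b\<in>sandpiles G. stable_add G a b = c)}"

section \<open>Principal avalanches\<close>

definition add_grain :: "('v \<Rightarrow> nat) \<Rightarrow> 'v \<Rightarrow> 'v \<Rightarrow> nat" where
  "add_grain c v = (\<lambda>w. c w + (if w = v then 1 else 0))"

definition avalanche_size :: "'v sink_graph \<Rightarrow> ('v \<Rightarrow> nat) \<Rightarrow> 'v \<Rightarrow> nat" where
  "avalanche_size G c v = (\<Sum>u\<in>nonsink G. toppling_vector G (add_grain c v) u)"

definition num_principal_avalanches :: "'v sink_graph \<Rightarrow> nat \<Rightarrow> nat" where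
  "num_principal_avalanches G m =
     card {(c, v). c \<in> recurrents G \<and> v \<in> nonsink G \<and> avalanche_size G c v = m}"

section \<open>Avalanche polynomials\<close>

text \<open>
  A polynomial is a finitely supported map from monomials (finitely supported exponent
  functions) to coefficients. The variables of the avalanche polynomial are indexed by the
  non-sink vertices themselves. Coefficients are rational because the expansion in elementary
  symmetric polynomials involves quotients of integers.
\<close>

type_synonym 'v mpoly = "('v \<Rightarrow>\<^sub>0 nat) \<Rightarrow>\<^sub>0 rat"

definition var :: "'v \<Rightarrow> 'v mpoly" where
  "var v = Poly_Mapping.single (Poly_Mapping.single v 1) 1"

definition const_poly :: "rat \<Rightarrow> 'v mpoly" where
  "const_poly q = Poly_Mapping.single 0 q"

definition elem_sym :: "'v set \<Rightarrow> nat \<Rightarrow> 'v mpoly" where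
  "elem_sym X m = (\<Sum>A | A \<subseteq> X \<and> card A = m. \<Prod>i\<in>A. var i)"

definition avalanche_monomial :: "'v sink_graph \<Rightarrow> ('v \<Rightarrow> nat) \<Rightarrow> 'v \<Rightarrow> 'v mpoly" where
  "avalanche_monomial G c v =
     (\<Prod>u\<in>nonsink G. var u ^ toppling_vector G (add_grain c v) u)"

definition avalanche_poly :: "'v sink_graph \<Rightarrow> 'v mpoly" where
  "avalanche_poly G = (\<Sum>c\<in>recurrents G. \<Sum>v\<in>nonsink G. avalanche_monomial G c v)"

section \<open>Complete graphs\<close>

text \<open>
  The complete graph on \<open>n + 1\<close> vertices: the sink is \<open>0\<close> and the other vertices
  are \<open>1, \<dots>, n\<close>, so that the variables of its avalanche polynomial are those with
  indices \<open>1, \<dots>, n\<close>.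
\<close>

definition complete_sink_graph :: "nat \<Rightarrow> nat sink_graph" where
  "complete_sink_graph n =
     \<lparr>verts = {0..n},
      wt = (\<lambda>u v. if u \<in> {0..n} \<and> v \<in> {0..n} \<and> u \<noteq> v then 1 else 0),
      sink = 0\<rparr>"

lemma nonsink_complete_sink_graph: "nonsink (complete_sink_graph n) = {1..n}"
  by (auto simp: nonsink_def complete_sink_graph_def)

lemma wf_complete_sink_graph: "wf_sink_graph (complete_sink_graph n)"
proof -
  let ?R = "\<lambda>x y. x \<in> verts (complete_sink_graph n) \<and> y \<in> verts (complete_sink_graph n) \<and>
                wt (complete_sink_graph n) x y > 0"
  have "?R\<^sup>*\<^sup>* u v" if "u \<le> n" "v \<le> n" for u v
  proof (cases "u = v")
    case False
    then have "?R u v"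
      using that by (simp add: complete_sink_graph_def)
    then show ?thesis
      by (rule r_into_rtranclp)
  qed simp
  then have "\<forall>u\<in>verts (complete_sink_graph n). \<forall>v\<in>verts (complete_sink_graph n). ?R\<^sup>*\<^sup>* u v"
    by (simp add: complete_sink_graph_def)
  then show ?thesis
    unfolding wf_sink_graph_def by (auto simp: complete_sink_graph_def)
qed

end

(* A legal toppling sequence never topples a vertex more often than a vector g such that firing g
   leaves every value below the degree (least action principle). If every vertex is joined to the
   sink, g can be a large constant vector, so stabilizations exist; for a stable sandpile plus one
   grain, g = 1 suffices, so every vertex topples at most once and the avalanche monomials are
   squarefree. Every permutation of the non-sink vertices of the complete graph is an automorphism,
   so the number of principal avalanches with support A depends only on the size m of A, hence is
   lambda_m / binomial(n, m). *)

theory Submission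
  imports Defs "HOL-Combinatorics.Permutations"
begin

section \<open>The least action principle\<close>

text \<open>The effect of firing every non-sink vertex \<open>u\<close> exactly \<open>g u\<close>
  times with no regard to legality; in a well-formed graph this is \<open>c\<close> minus the
  reduced Laplacian applied to \<open>g\<close>. Values are integers because unstable and illegal
  firings are treated alike, so they may become negative.\<close>

definition fire :: "'v sink_graph \<Rightarrow> ('v \<Rightarrow> nat) \<Rightarrow> ('v \<Rightarrow> nat) \<Rightarrow> 'v \<Rightarrow> int" where
  "fire G g c w = int (c w) - int (deg G w * g w) + (\<Sum>u\<in>nonsink G - {w}. int (wt G u w * g u))"

text \<open>Instability of \<open>v\<close> keeps the natural subtraction in \<open>topple\<close>
  exact, so a legal toppling is just one more firing of \<open>v\<close> and can be absorbed into
  the vector.\<close>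

lemma fire_topple:
  assumes "finite (verts G)" "unstable G c v" "w \<in> nonsink G"
  shows "fire G g (topple G v c) w = fire G (g(v := Suc (g v))) c w"
proof (cases "w = v")
  case True
  have "(\<Sum>u\<in>nonsink G - {w}. int (wt G u w * (g(v := Suc (g v))) u)) =
      (\<Sum>u\<in>nonsink G - {w}. int (wt G u w * g u))"
    using True by (intro sum.cong) auto
  then show ?thesis
    using True assms(2) by (simp add: fire_def topple_def unstable_def of_nat_diff algebra_simps)
next
  case False
  have fin: "finite (nonsink G - {w})" and v: "v \<in> nonsink G - {w}"
    using assms False by (auto simp: nonsink_def unstable_def)
  have "(\<Sum>u\<in>nonsink G - {w}. int (wt G u w * (g(v := Suc (g v))) u)) =
      (\<Sum>u\<in>nonsink G - {w}. int (wt G u w * g u) + (if u = v then int (wt G v w) else 0))"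
    by (intro sum.cong) (auto simp: algebra_simps)
  also have "\<dots> = (\<Sum>u\<in>nonsink G - {w}. int (wt G u w * g u)) + int (wt G v w)"
    using fin v by (simp add: sum.distrib)
  finally show ?thesis
    using False assms(3) by (simp add: fire_def topple_def)
qed

lemma topplings_fire:
  assumes "topplings G c vs c'" "finite (verts G)" "w \<in> nonsink G"
  shows "int (c' w) = fire G (count_list vs) c w"
  using assms
proof (induction rule: topplings.induct)
  case (Nil c)
  then show ?case by (simp add: fire_def)
next
  case (Cons c v vs c')
  moreover have "count_list (v # vs) = (count_list vs)(v := Suc (count_list vs v))" by auto
  ultimately show ?case
    by (simp only: fire_topple)
qed

lemma topplings_outside:
  assumes "topplings G c vs c'" "w \<notin> nonsink G"
  shows "c' w = c w"
  using assms by (induction rule: topplings.induct) (auto simp: topple_def unstable_def)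

text \<open>A vertex that never fires can only gain grains, so if it is unstable it stays at or
  above its degree.\<close>

lemma fire_unstable_pos:
  assumes "unstable G c v" "fire G g c v < int (deg G v)"
  shows "0 < g v"
proof (rule ccontr)
  assume "\<not> 0 < g v"
  then have "fire G g c v \<ge> int (c v)"
    by (simp add: fire_def sum_nonneg)
  then show False
    using assms by (simp add: unstable_def)
qed

lemma fire_topple_pred:
  assumes "finite (verts G)" "unstable G c v" "w \<in> nonsink G" "0 < g v"
  shows "fire G (g(v := g v - 1)) (topple G v c) w = fire G g c w"
  using assms by (simp add: fire_topple)

text \<open>Induction on the sequence with \<open>g\<close> as a budget: the first vertex toppled is
  unstable, so its budget is positive. Deducting one unit there leaves the result of firing
  unchanged, so the bound on \<open>fire\<close> passes to the rest.\<close>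

theorem least_action:
  assumes "topplings G c vs c'" "finite (verts G)"
    and "\<And>w. w \<in> nonsink G \<Longrightarrow> fire G g c w < int (deg G w)"
  shows "count_list vs u \<le> g u"
  using assms
proof (induction arbitrary: g u rule: topplings.induct)
  case (Nil c)
  then show ?case by simp
next
  case (Cons c v vs c')
  have pos: "0 < g v"
    using Cons.hyps Cons.prems(2) by (intro fire_unstable_pos) (auto simp: unstable_def)
  have "count_list vs u \<le> (g(v := g v - 1)) u"
    using Cons.hyps Cons.prems pos by (intro Cons.IH) (auto simp del: fun_upd_apply One_nat_def simp: fire_topple_pred)
  then show ?case
    using pos by (auto split: if_splits)
qed

section \<open>Existence and uniqueness of stabilizations\<close>

text \<open>The total budget is the termination measure: each legal toppling spends one unit of
  \<open>g\<close>, and an unstable vertex always has a unit left.\<close>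

lemma ex_stabilizing_topplings:
  assumes "finite (verts G)" "\<And>w. w \<in> nonsink G \<Longrightarrow> fire G g c w < int (deg G w)"
  shows "\<exists>vs c'. topplings G c vs c' \<and> stable G c'"
  using assms(2)
proof (induction "\<Sum>u\<in>nonsink G. g u" arbitrary: g c rule: less_induct)
  case less
  show ?case
  proof (cases "stable G c")
    case True
    then show ?thesis using topplings.Nil by blast
  next
    case False
    then obtain v where v: "unstable G c v" by (auto simp: stable_def)
    then have vn: "v \<in> nonsink G" by (simp add: unstable_def)
    then have pos: "0 < g v" using fire_unstable_pos[OF v] less.prems by blast
    have "(\<Sum>u\<in>nonsink G. (g(v := g v - 1)) u) < (\<Sum>u\<in>nonsink G. g u)"
      using assms(1) vn pos by (intro sum_strict_mono_ex1) (auto simp: nonsink_def)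
    then have "\<exists>vs c'. topplings G (topple G v c) vs c' \<and> stable G c'"
      using less.prems assms(1) v pos
      by (intro less.hyps) (auto simp del: fun_upd_apply One_nat_def simp: fire_topple_pred)
    then show ?thesis using topplings.Cons[OF v] by blast
  qed
qed

text \<open>The counts of either stabilizing sequence are an admissible \<open>g\<close> for the
  other, because firing them ends in a stable sandpile. Least action then gives both
  inequalities.\<close>

lemma stabilizing_count_list_unique:
  assumes "finite (verts G)"
    and "topplings G c vs c'" "stable G c'" "topplings G c vs' c''" "stable G c''"
  shows "count_list vs = count_list vs'"
proof -
  have le: "count_list ws u \<le> count_list ws' u"
    if "topplings G c ws d" "topplings G c ws' d'" "stable G d'" for ws ws' d d' u
  proof (rule least_action[OF that(1) assms(1)])
    fix w assume w: "w \<in> nonsink G"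
    then have "d' w < deg G w"
      using that(3) by (auto simp: stable_def unstable_def not_le)
    then show "fire G (count_list ws') c w < int (deg G w)"
      using topplings_fire[OF that(2) assms(1) w] by simp
  qed
  show ?thesis
    using le[OF assms(2,4,5)] le[OF assms(4,2,3)] by (intro ext antisym)
qed

lemma toppling_vector_eqI:
  assumes "finite (verts G)" "topplings G c vs c'" "stable G c'"
  shows "toppling_vector G c = count_list vs"
  unfolding toppling_vector_def
  by (rule the_equality) (use assms stabilizing_count_list_unique[OF assms(1)] in blast)+

text \<open>Equal toppling counts force equal final sandpiles: on non-sink vertices
  \<open>fire\<close> computes the value from the counts, and elsewhere no toppling changes
  anything.\<close>

lemma stabilization_eqI:
  assumes "finite (verts G)" "topplings G c vs c'" "stable G c'"
  shows "stabilization G c = c'"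
  unfolding stabilization_def
proof (rule the_equality)
  show "stable G c' \<and> (\<exists>vs. topplings G c vs c')" using assms by blast
next
  fix d assume "stable G d \<and> (\<exists>vs. topplings G c vs d)"
  then obtain ws where ws: "topplings G c ws d" "stable G d" by blast
  have eq: "count_list ws = count_list vs"
    by (rule stabilizing_count_list_unique[OF assms(1) ws assms(2,3)])
  show "d = c'"
  proof
    fix w
    show "d w = c' w"
    proof (cases "w \<in> nonsink G")
      case True
      then show ?thesis
        using topplings_fire[OF ws(1) assms(1) True] topplings_fire[OF assms(2,1) True] eq by simp
    next
      case False
      then show ?thesis
        using topplings_outside[OF ws(1) False] topplings_outside[OF assms(2) False] by simp
    qed
  qed
qed

section \<open>Graphs in which every vertex is joined to the sink\<close>

text \<open>A direct edge to the sink, rather than mere connectedness, makes every non-sink vertex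
  lose a grain when all of them fire once, so constant vectors can serve as
  \<open>g\<close>.\<close>

locale sink_adjacent_graph =
  fixes G :: "'v sink_graph"
  assumes wf: "wf_sink_graph G"
    and sink_adjacent: "v \<in> nonsink G \<Longrightarrow> 0 < wt G v (sink G)"
begin

lemma finite_verts: "finite (verts G)"
  using wf by (simp add: wf_sink_graph_def)

lemma finite_nonsink: "finite (nonsink G)"
  using finite_verts by (simp add: nonsink_def)

text \<open>The last sum has the orientation used in \<open>fire\<close>, so that exchanges among
  non-sink vertices cancel under a constant vector.\<close>

lemma deg_eq:
  assumes "w \<in> nonsink G"
  shows "deg G w = wt G w (sink G) + (\<Sum>u\<in>nonsink G - {w}. wt G u w)"
proof -
  have w: "w \<in> verts G" and s: "sink G \<in> verts G"
    using assms wf by (auto simp: nonsink_def wf_sink_graph_def)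
  have "deg G w = wt G w (sink G) + (\<Sum>u\<in>nonsink G. wt G w u)"
    unfolding deg_def nonsink_def by (rule sum.remove[OF finite_verts s])
  also have "(\<Sum>u\<in>nonsink G. wt G w u) = (\<Sum>u\<in>nonsink G - {w}. wt G w u)"
    using sum.remove[OF finite_nonsink assms, of "wt G w"] w wf by (simp add: wf_sink_graph_def)
  also have "\<dots> = (\<Sum>u\<in>nonsink G - {w}. wt G u w)"
    using w wf by (intro sum.cong) (auto simp: wf_sink_graph_def nonsink_def)
  finally show ?thesis .
qed

lemma deg_pos: "w \<in> nonsink G \<Longrightarrow> 0 < deg G w"
  using deg_eq sink_adjacent by fastforce

text \<open>In each round a vertex gets back what it sends to non-sink neighbours and loses only its
  edges to the sink, at least one.\<close>

lemma fire_const_le: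
  assumes "w \<in> nonsink G"
  shows "fire G (\<lambda>_. k) c w \<le> int (c w) - int k"
proof -
  have "fire G (\<lambda>_. k) c w = int (c w) - int (wt G w (sink G)) * int k"
    unfolding fire_def deg_eq[OF assms]
    by (simp add: sum_distrib_left algebra_simps)
  moreover have "1 * int k \<le> int (wt G w (sink G)) * int k"
    using sink_adjacent[OF assms] by (intro mult_right_mono) auto
  ultimately show ?thesis by simp
qed

lemma stabilizable: "\<exists>vs c'. topplings G c vs c' \<and> stable G c'"
proof (rule ex_stabilizing_topplings[OF finite_verts])
  fix w assume w: "w \<in> nonsink G"
  \<comment> \<open>The total number of grains bounds every single value, so this many rounds bring
    all values to at most 0, below the positive degrees.\<close>
  let ?k = "\<Sum>u\<in>nonsink G. c u"
  have "c w \<le> ?k"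
    using w finite_nonsink by (intro member_le_sum) auto
  then show "fire G (\<lambda>_. ?k) c w < int (deg G w)"
    using fire_const_le[OF w, of ?k c] deg_pos[OF w] by linarith
qed

text \<open>The extra grain lifts a value at most to the degree, and one round of firing everything
  brings it below again, so the constant 1 is an admissible vector.\<close>

lemma toppling_vector_add_grain_le_1:
  assumes "stable G c"
  shows "toppling_vector G (add_grain c v) u \<le> 1"
proof -
  obtain vs c' where vs: "topplings G (add_grain c v) vs c'" "stable G c'"
    using stabilizable by blast
  have "count_list vs u \<le> 1"
  proof (rule least_action[OF vs(1) finite_verts])
    fix w assume w: "w \<in> nonsink G"
    have "c w < deg G w"
      using assms w by (auto simp: stable_def unstable_def not_le)
    moreover have "add_grain c v w \<le> c w + 1"
      by (simp add: add_grain_def)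
    ultimately show "fire G (\<lambda>_. 1) (add_grain c v) w < int (deg G w)"
      using fire_const_le[OF w, of 1 "add_grain c v"] by linarith
  qed
  then show ?thesis
    using toppling_vector_eqI[OF finite_verts vs] by simp
qed

lemma finite_recurrents: "finite (recurrents G)"
proof (rule finite_subset)
  \<comment> \<open>One bound for all vertices at once, giving a common finite range.\<close>
  let ?M = "\<Sum>u\<in>nonsink G. deg G u"
  show "recurrents G \<subseteq>
    {c. \<forall>v. (v \<in> nonsink G \<longrightarrow> c v \<in> {..?M}) \<and> (v \<notin> nonsink G \<longrightarrow> c v = 0)}"
  proof safe
    fix c v assume "c \<in> recurrents G" "v \<in> nonsink G"
    then have "c v < deg G v"
      by (auto simp: recurrents_def stable_def unstable_def not_le)
    also have "deg G v \<le> ?M"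
      using \<open>v \<in> nonsink G\<close> finite_nonsink by (intro member_le_sum) auto
    finally show "c v \<le> ?M" by simp
  qed (auto simp: recurrents_def sandpiles_def)
  show "finite {c. \<forall>v. (v \<in> nonsink G \<longrightarrow> c v \<in> {..?M}) \<and> (v \<notin> nonsink G \<longrightarrow> c v = 0)}"
    by (intro finite_set_of_finite_funs finite_nonsink) auto
qed

section \<open>Sorting principal avalanches by support\<close>

text \<open>For recurrent \<open>c\<close> the toppling vector is the indicator of this set, which
  therefore determines both the monomial and the size of the avalanche.\<close>

definition avalanche_support :: "('v \<Rightarrow> nat) \<Rightarrow> 'v \<Rightarrow> 'v set" where
  "avalanche_support c v = {u \<in> nonsink G. 0 < toppling_vector G (add_grain c v) u}"

definition avalanches_with_support :: "'v set \<Rightarrow> (('v \<Rightarrow> nat) \<times> 'v) set" where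
  "avalanches_with_support A =
     {(c, v). c \<in> recurrents G \<and> v \<in> nonsink G \<and> avalanche_support c v = A}"

lemma avalanche_support_subset: "avalanche_support c v \<subseteq> nonsink G"
  by (auto simp: avalanche_support_def)

lemma finite_avalanches_with_support: "finite (avalanches_with_support A)"
  by (rule finite_subset[of _ "recurrents G \<times> nonsink G"])
    (auto simp: avalanches_with_support_def finite_recurrents finite_nonsink)

lemma toppling_vector_eq_indicator:
  assumes "c \<in> recurrents G" "u \<in> nonsink G"
  shows "toppling_vector G (add_grain c v) u = (if u \<in> avalanche_support c v then 1 else 0)"
  using toppling_vector_add_grain_le_1[of c v u] assms
  by (auto simp: recurrents_def avalanche_support_def)

lemma avalanche_size_eq_card:
  assumes "c \<in> recurrents G"
  shows "avalanche_size G c v = card (avalanche_support c v)"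
proof -
  have "avalanche_size G c v = (\<Sum>u\<in>nonsink G. if u \<in> avalanche_support c v then 1 else 0)"
    unfolding avalanche_size_def using assms
    by (intro sum.cong) (auto simp: toppling_vector_eq_indicator)
  also have "\<dots> = card (nonsink G \<inter> avalanche_support c v)"
    by (simp add: sum.If_cases[OF finite_nonsink])
  finally show ?thesis
    using avalanche_support_subset[of c v] by (simp add: Int_absorb1)
qed

lemma avalanche_monomial_eq_prod:
  assumes "c \<in> recurrents G"
  shows "avalanche_monomial G c v = (\<Prod>u\<in>avalanche_support c v. var u)"
proof -
  have "avalanche_monomial G c v =
      (\<Prod>u\<in>nonsink G. if u \<in> avalanche_support c v then var u else 1)"
    unfolding avalanche_monomial_def using assms
    by (intro prod.cong) (auto simp: toppling_vector_eq_indicator)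
  also have "\<dots> = (\<Prod>u\<in>nonsink G \<inter> avalanche_support c v. var u)"
    by (simp add: prod.If_cases[OF finite_nonsink])
  finally show ?thesis
    using avalanche_support_subset[of c v] by (simp add: Int_absorb1)
qed

text \<open>Pairs with the same support contribute the same squarefree monomial, so grouping by
  support turns coefficients into counts.\<close>

lemma avalanche_poly_by_support:
  "avalanche_poly G =
     (\<Sum>A\<in>Pow (nonsink G). of_nat (card (avalanches_with_support A)) * (\<Prod>u\<in>A. var u))"
proof -
  let ?S = "recurrents G \<times> nonsink G"
  have fin: "finite ?S" by (simp add: finite_recurrents finite_nonsink)
  have "avalanche_poly G = (\<Sum>(c, v)\<in>?S. \<Prod>u\<in>avalanche_support c v. var u)"
    unfolding avalanche_poly_def sum.cartesian_product
    by (intro sum.cong) (auto simp: avalanche_monomial_eq_prod)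
  also have "\<dots> = (\<Sum>A\<in>Pow (nonsink G). \<Sum>p\<in>{p \<in> ?S. case_prod avalanche_support p = A}.
      \<Prod>u\<in>case_prod avalanche_support p. var u)"
    using avalanche_support_subset
    by (subst sum.group) (auto simp: fin finite_nonsink case_prod_unfold)
  also have "\<dots> = (\<Sum>A\<in>Pow (nonsink G). \<Sum>p\<in>avalanches_with_support A. \<Prod>u\<in>A. var u)"
    by (intro sum.cong) (auto simp: avalanches_with_support_def)
  finally show ?thesis by simp
qed

text \<open>Size is the cardinality of the support, so the avalanches of size \<open>m\<close> split
  disjointly over the supports with \<open>m\<close> elements.\<close>

lemma num_principal_avalanches_by_support:
  "num_principal_avalanches G m =
     (\<Sum>A | A \<subseteq> nonsink G \<and> card A = m. card (avalanches_with_support A))"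
proof -
  have "{(c, v). c \<in> recurrents G \<and> v \<in> nonsink G \<and> avalanche_size G c v = m} =
      (\<Union>A\<in>{A. A \<subseteq> nonsink G \<and> card A = m}. avalanches_with_support A)"
    using avalanche_support_subset
    by (auto simp: avalanches_with_support_def avalanche_size_eq_card)
  then show ?thesis
    unfolding num_principal_avalanches_def
    by (simp only:, intro card_UN_disjoint)
      (simp_all add: finite_nonsink finite_avalanches_with_support,
       auto simp: avalanches_with_support_def)
qed

end

section \<open>Automorphisms\<close>

text \<open>\<open>permutes\<close> fixes all points other than the non-sink vertices, the sink
  included, so \<open>c \<circ> \<pi>\<close> still vanishes off the non-sink vertices whenever
  \<open>c\<close> does.\<close>

locale sink_graph_automorphism = sink_adjacent_graph G for G :: "'v sink_graph" +
  fixes \<pi> :: "'v \<Rightarrow> 'v"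
  assumes permutes: "\<pi> permutes nonsink G"
    and wt_invariant: "u \<in> verts G \<Longrightarrow> v \<in> verts G \<Longrightarrow> wt G (\<pi> u) (\<pi> v) = wt G u v"
begin

lemma permutes_verts: "\<pi> permutes verts G"
  by (rule permutes_subset[OF permutes]) (auto simp: nonsink_def)

lemma mem_nonsink_iff: "\<pi> v \<in> nonsink G \<longleftrightarrow> v \<in> nonsink G"
  by (rule permutes_in_image[OF permutes])

lemma pi_inv: "\<pi> (inv \<pi> v) = v" and inv_pi: "inv \<pi> (\<pi> v) = v"
  using permutes by (simp_all add: permutes_inverses)

lemma deg_invariant:
  assumes "v \<in> verts G"
  shows "deg G (\<pi> v) = deg G v"
proof -
  have "deg G (\<pi> v) = (\<Sum>u\<in>verts G. wt G (\<pi> v) (\<pi> u))"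
    unfolding deg_def by (subst sum.permute[OF permutes_verts]) (simp add: o_def)
  also have "\<dots> = deg G v"
    unfolding deg_def using assms by (simp add: wt_invariant)
  finally show ?thesis .
qed

lemma unstable_comp_iff: "unstable G (c \<circ> \<pi>) v \<longleftrightarrow> unstable G c (\<pi> v)"
  using mem_nonsink_iff[of v] deg_invariant[of v] by (auto simp: unstable_def nonsink_def)

lemma stable_comp:
  assumes "stable G c"
  shows "stable G (c \<circ> \<pi>)"
  using assms by (simp add: stable_def unstable_comp_iff)

lemma topple_comp:
  assumes "v \<in> nonsink G"
  shows "topple G (\<pi> v) c \<circ> \<pi> = topple G v (c \<circ> \<pi>)"
proof
  fix w
  have "\<pi> w = \<pi> v \<longleftrightarrow> w = v" by (metis inv_pi)
  then show "(topple G (\<pi> v) c \<circ> \<pi>) w = topple G v (c \<circ> \<pi>) w"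
    using assms deg_invariant[of v] wt_invariant[of v w] mem_nonsink_iff[of w]
    by (auto simp: topple_def nonsink_def)
qed

text \<open>Sandpiles are pulled back along \<open>\<pi>\<close>, so what happens at
  \<open>v\<close> in \<open>c\<close> happens at \<open>inv \<pi> v\<close> in
  \<open>c \<circ> \<pi>\<close>; hence the inverse on the sequence.\<close>

lemma topplings_comp:
  assumes "topplings G c vs c'"
  shows "topplings G (c \<circ> \<pi>) (map (inv \<pi>) vs) (c' \<circ> \<pi>)"
  using assms
proof (induction rule: topplings.induct)
  case (Nil c)
  then show ?case by (simp add: topplings.Nil)
next
  case (Cons c v vs c')
  have "unstable G (c \<circ> \<pi>) (inv \<pi> v)"
    using Cons.hyps(1) by (simp add: unstable_comp_iff pi_inv)
  moreover have "topple G (inv \<pi> v) (c \<circ> \<pi>) = topple G v c \<circ> \<pi>"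
    using topple_comp[of "inv \<pi> v" c] calculation by (simp add: pi_inv unstable_def)
  ultimately show ?case
    using Cons.IH by (simp only: list.map topplings.Cons)
qed

lemma count_list_map_inv: "count_list (map (inv \<pi>) vs) = count_list vs \<circ> \<pi>"
proof
  fix u
  show "count_list (map (inv \<pi>) vs) u = (count_list vs \<circ> \<pi>) u"
    by (induction vs) (auto simp: pi_inv inv_pi)
qed

text \<open>A single stabilizing sequence determines the vector, and its transport stabilizes the
  pulled-back sandpile.\<close>

lemma toppling_vector_comp: "toppling_vector G (c \<circ> \<pi>) = toppling_vector G c \<circ> \<pi>"
proof -
  obtain vs c' where "topplings G c vs c'" "stable G c'" using stabilizable by blast
  then show ?thesis
    using toppling_vector_eqI[OF finite_verts] topplings_comp stable_comp count_list_map_inv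
    by metis
qed

lemma stabilization_comp: "stabilization G (c \<circ> \<pi>) = stabilization G c \<circ> \<pi>"
proof -
  obtain vs c' where "topplings G c vs c'" "stable G c'" using stabilizable by blast
  then show ?thesis
    using stabilization_eqI[OF finite_verts] topplings_comp stable_comp by metis
qed

lemma sandpiles_comp: "c \<in> sandpiles G \<Longrightarrow> c \<circ> \<pi> \<in> sandpiles G"
  by (simp add: sandpiles_def mem_nonsink_iff)

lemma sandpiles_comp_inv: "c \<in> sandpiles G \<Longrightarrow> c \<circ> inv \<pi> \<in> sandpiles G"
  using permutes_in_image[OF permutes_inv[OF permutes]] by (simp add: sandpiles_def)

lemma recurrents_comp:
  assumes "c \<in> recurrents G"
  shows "c \<circ> \<pi> \<in> recurrents G"
proof -
  have "\<exists>b\<in>sandpiles G. stable_add G a b = c \<circ> \<pi>" if a: "a \<in> sandpiles G" for a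
  proof -
    \<comment> \<open>Recurrence of \<open>c\<close> is used for \<open>a\<close> moved by the
      inverse; pulling the resulting \<open>b\<close> back along \<open>\<pi>\<close> gives the
      witness for \<open>a\<close> itself.\<close>
    obtain b where b: "b \<in> sandpiles G" "stable_add G (a \<circ> inv \<pi>) b = c"
      using assms sandpiles_comp_inv[OF a] by (auto simp: recurrents_def)
    have "(\<lambda>v. a v + (b \<circ> \<pi>) v) = (\<lambda>v. (a \<circ> inv \<pi>) v + b v) \<circ> \<pi>"
      by (auto simp: inv_pi)
    then have "stable_add G a (b \<circ> \<pi>) = c \<circ> \<pi>"
      using b(2) by (simp add: stable_add_def stabilization_comp)
    then show ?thesis using sandpiles_comp[OF b(1)] by blast
  qed
  then show ?thesis
    using assms by (simp add: recurrents_def sandpiles_comp stable_comp)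
qed

lemma add_grain_comp: "add_grain (c \<circ> \<pi>) (inv \<pi> v) = add_grain c v \<circ> \<pi>"
proof
  fix w
  have "w = inv \<pi> v \<longleftrightarrow> \<pi> w = v" by (metis pi_inv inv_pi)
  then show "add_grain (c \<circ> \<pi>) (inv \<pi> v) w = (add_grain c v \<circ> \<pi>) w"
    by (simp add: add_grain_def)
qed

lemma avalanche_support_comp:
  "avalanche_support (c \<circ> \<pi>) (inv \<pi> v) = \<pi> -` avalanche_support c v"
  by (auto simp: avalanche_support_def add_grain_comp toppling_vector_comp mem_nonsink_iff)

text \<open>Pulling back the sandpile and moving the grain by \<open>inv \<pi>\<close> is injective.
  An inequality is enough, since another permutation supplies the reverse one.\<close>

lemma card_avalanches_with_support_le:
  "card (avalanches_with_support A) \<le> card (avalanches_with_support (\<pi> -` A))"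
proof (rule card_inj_on_le)
  let ?h = "\<lambda>(c, v). (c \<circ> \<pi>, inv \<pi> v)"
  show "inj_on ?h (avalanches_with_support A)"
  proof (rule inj_onI, clarify)
    fix c v c' v' assume *: "c \<circ> \<pi> = c' \<circ> \<pi>" "inv \<pi> v = inv \<pi> v'"
    have "c x = c' x" for x
      using fun_cong[OF *(1), of "inv \<pi> x"] by (simp add: pi_inv)
    moreover have "v = v'" using *(2) by (metis pi_inv)
    ultimately show "c = c' \<and> v = v'" by auto
  qed
  show "?h ` avalanches_with_support A \<subseteq> avalanches_with_support (\<pi> -` A)"
    using permutes_in_image[OF permutes_inv[OF permutes]]
    by (auto simp: avalanches_with_support_def recurrents_comp avalanche_support_comp)
qed (rule finite_avalanches_with_support)

end

section \<open>Complete graphs\<close>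

text \<open>The complements in \<open>S\<close> also have equal size, so a bijection from
  \<open>A\<close> to \<open>B\<close> is glued to one between the complements and extended by the
  identity.\<close>

lemma ex_permutes_image_eq:
  assumes "finite S" "A \<subseteq> S" "B \<subseteq> S" "card A = card B"
  shows "\<exists>\<pi>. \<pi> permutes S \<and> \<pi> ` A = B"
proof -
  have fin: "finite A" "finite B" using assms finite_subset by auto
  obtain f where f: "bij_betw f A B"
    using fin assms(4) finite_same_card_bij by blast
  have "card (S - A) = card (S - B)"
    using assms fin by (simp add: card_Diff_subset)
  then obtain g where g: "bij_betw g (S - A) (S - B)"
    using assms(1) finite_same_card_bij by (metis finite_Diff)
  let ?p = "\<lambda>x. if x \<in> A then f x else if x \<in> S then g x else x"
  have A: "bij_betw ?p A B" and SA: "bij_betw ?p (S - A) (S - B)"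
    using bij_betw_cong[of A ?p f] bij_betw_cong[of "S - A" ?p g] f g by simp_all
  have "bij_betw ?p (A \<union> (S - A)) (B \<union> (S - B))"
    by (rule bij_betw_combine[OF A SA]) auto
  then have "bij_betw ?p S S" using assms by (simp add: Un_absorb1)
  then have "?p permutes S" by (rule bij_imp_permutes) (use assms in auto)
  moreover have "?p ` A = B" using A by (simp add: bij_betw_def)
  ultimately show ?thesis by blast
qed

interpretation complete: sink_adjacent_graph "complete_sink_graph n" for n
proof
  show "wf_sink_graph (complete_sink_graph n)" by (rule wf_complete_sink_graph)
  fix v assume "v \<in> nonsink (complete_sink_graph n)"
  then show "0 < wt (complete_sink_graph n) v (sink (complete_sink_graph n))"
    by (auto simp: nonsink_complete_sink_graph) (auto simp: complete_sink_graph_def)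
qed

text \<open>Edge multiplicities depend only on whether two vertices are distinct, which an injective
  map preserves.\<close>

lemma complete_automorphism:
  assumes "\<pi> permutes {1..n}"
  shows "sink_graph_automorphism (complete_sink_graph n) \<pi>"
proof
  show "\<pi> permutes nonsink (complete_sink_graph n)"
    using assms by (simp add: nonsink_complete_sink_graph)
  have "\<pi> permutes {0..n}"
    by (rule permutes_subset[OF assms]) auto
  then show "wt (complete_sink_graph n) (\<pi> u) (\<pi> v) = wt (complete_sink_graph n) u v" for u v
    using permutes_in_image[of \<pi> "{0..n}"] permutes_inj[OF assms]
    by (auto simp: complete_sink_graph_def inj_eq)
qed

lemma card_avalanches_with_support_le_complete:
  assumes "A \<subseteq> {1..n}" "B \<subseteq> {1..n}" "card A = card B"
  shows "card (complete.avalanches_with_support n A) \<le> card (complete.avalanches_with_support n B)"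
proof -
  \<comment> \<open>The permutation carries \<open>B\<close> to \<open>A\<close>, not conversely,
    because supports move by preimage.\<close>
  obtain \<pi> where \<pi>: "\<pi> permutes {1..n}" "\<pi> ` B = A"
    using ex_permutes_image_eq[of "{1..n}" B A] assms by auto
  interpret sink_graph_automorphism "complete_sink_graph n" \<pi>
    by (rule complete_automorphism[OF \<pi>(1)])
  have "\<pi> -` A = B"
    using \<pi> permutes_inj[OF \<pi>(1)] inj_vimage_image_eq by blast
  then show ?thesis
    using card_avalanches_with_support_le[of A] by simp
qed

text \<open>Applying the inequality in both directions makes all supports of the same size equally
  frequent, and there are \<open>n choose card A\<close> of them.\<close>

lemma num_principal_avalanches_complete:
  assumes "A \<subseteq> {1..n}"
  shows "num_principal_avalanches (complete_sink_graph n) (card A) =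
    (n choose card A) * card (complete.avalanches_with_support n A)"
proof -
  have "num_principal_avalanches (complete_sink_graph n) (card A) =
      (\<Sum>B | B \<subseteq> {1..n} \<and> card B = card A. card (complete.avalanches_with_support n A))"
    unfolding complete.num_principal_avalanches_by_support nonsink_complete_sink_graph
    using assms by (intro sum.cong refl antisym card_avalanches_with_support_le_complete) auto
  then show ?thesis
    by (simp add: n_subsets)
qed

section \<open>Expansion in elementary symmetric polynomials\<close>

lemma const_poly_of_nat: "const_poly (of_nat k) = of_nat k"
  by (simp add: const_poly_def)

theorem proposition35:
  fixes n :: nat
  assumes "n \<ge> 1"
  shows "avalanche_poly (complete_sink_graph n) =
    (\<Sum>m=0..n.
       const_poly (of_nat (num_principal_avalanches (complete_sink_graph n) m) / of_nat (n choose m))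
         * elem_sym {1..n} m)"
proof -
  let ?N = "num_principal_avalanches (complete_sink_graph n)"
  let ?q = "\<lambda>m. const_poly (of_nat (?N m) / of_nat (n choose m)) :: nat mpoly"
  have card_le: "card A \<le> n" if "A \<subseteq> {1..n}" for A
    using card_mono[OF _ that] by simp
  have "avalanche_poly (complete_sink_graph n) =
      (\<Sum>A\<in>Pow {1..n}. of_nat (card (complete.avalanches_with_support n A)) * (\<Prod>u\<in>A. var u))"
    unfolding complete.avalanche_poly_by_support nonsink_complete_sink_graph ..
  also have "\<dots> = (\<Sum>A\<in>Pow {1..n}. ?q (card A) * (\<Prod>u\<in>A. var u))"
  proof (intro sum.cong refl)
    fix A assume "A \<in> Pow {1..n}"
    then have A: "A \<subseteq> {1..n}" by simp
    \<comment> \<open>Since \<open>card A \<le> n\<close>, the binomial coefficient is nonzero and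
      the quotient is exactly the number of avalanches with support \<open>A\<close>.\<close>
    have "of_nat (?N (card A)) / of_nat (n choose card A) =
        (of_nat (card (complete.avalanches_with_support n A)) :: rat)"
      unfolding num_principal_avalanches_complete[OF A] using card_le[OF A] by simp
    then show "of_nat (card (complete.avalanches_with_support n A)) * (\<Prod>u\<in>A. var u) =
        ?q (card A) * (\<Prod>u\<in>A. var u)"
      by (simp only: const_poly_of_nat)
  qed
  \<comment> \<open>The coefficient now depends on \<open>A\<close> only through its size, so within
    each group it factors out and leaves \<open>elem_sym\<close>.\<close>
  also have "\<dots> = (\<Sum>m\<in>{0..n}. \<Sum>A\<in>{A \<in> Pow {1..n}. card A = m}. ?q (card A) * (\<Prod>u\<in>A. var u))"
    using card_le by (subst sum.group) auto
  also have "\<dots> = (\<Sum>m=0..n. ?q m * elem_sym {1..n} m)"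
    unfolding elem_sym_def sum_distrib_left by (intro sum.cong) auto
  finally show ?thesis .
qed

end
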